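(* Let $(X,\rho)$ be a metric space. Then the following two statements are equivalent. (i) $(X,\rho)$ is uniformly disconnected. (ii) There is a constant $M_0>0$ such that for any $\delta>0$ and any $\delta$-connected component $U$ of $X$, $\mathrm{diam}(U)\le M_0\delta$.
   Context: For $\delta_0>0$, a $\delta_0$-sequence in $(X,\rho)$ is a sequence of distinct points $(x_0,x_1,\dots,x_n)$, $n\ge1$, with $\rho(x_i,x_{i+1})\le\delta_0\,\rho(x_0,x_n)$ for all $0\le i\le n-1$. $(X,\rho)$ is uniformly disconnected if there is $\delta_0>0$ such that no $\delta_0$-sequence exists in $X$. For $\delta>0$, points $x,y\in X$ are $\delta$-equivalent if there is a finite sequence $x=z_1,\dots,z_n=y$ in $X$ with $\rho(z_i,z_{i+1})\le\delta$ for $1\le i\le n-1$. This is an equivalence relation; a $\delta$-connected component of $X$ is an equivalence class. *)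

theory Defs
  imports "HOL-Analysis.Analysis"
begin

(* The list [x_0, ..., x_n]; n >= 1 becomes length >= 2. *)
definition delta_sequence :: "'a set \<Rightarrow> ('a \<Rightarrow> 'a \<Rightarrow> real) \<Rightarrow> real \<Rightarrow> 'a list \<Rightarrow> bool" where
  "delta_sequence X \<rho> \<delta>\<^sub>0 xs \<longleftrightarrow>
     set xs \<subseteq> X \<and> distinct xs \<and> length xs \<ge> 2 \<and>
     (\<forall>i. Suc i < length xs \<longrightarrow> \<rho> (xs ! i) (xs ! Suc i) \<le> \<delta>\<^sub>0 * \<rho> (hd xs) (last xs))"

definition uniformly_disconnected :: "'a set \<Rightarrow> ('a \<Rightarrow> 'a \<Rightarrow> real) \<Rightarrow> bool" where
  "uniformly_disconnected X \<rho> \<longleftrightarrow> (\<exists>\<delta>\<^sub>0>0. \<not> (\<exists>xs. delta_sequence X \<rho> \<delta>\<^sub>0 xs))"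

definition delta_equiv :: "'a set \<Rightarrow> ('a \<Rightarrow> 'a \<Rightarrow> real) \<Rightarrow> real \<Rightarrow> ('a \<times> 'a) set" where
  "delta_equiv X \<rho> \<delta> =
     {(x, y). \<exists>zs. zs \<noteq> [] \<and> set zs \<subseteq> X \<and> hd zs = x \<and> last zs = y \<and>
        (\<forall>i. Suc i < length zs \<longrightarrow> \<rho> (zs ! i) (zs ! Suc i) \<le> \<delta>)}"

definition delta_components :: "'a set \<Rightarrow> ('a \<Rightarrow> 'a \<Rightarrow> real) \<Rightarrow> real \<Rightarrow> 'a set set" where
  "delta_components X \<rho> \<delta> = X // delta_equiv X \<rho> \<delta>"

(* Extended-valued, so that unbounded sets have diameter \<infinity>; the library's real-valued
   diameter is unspecified on them and is tied to the metric_space type class. *)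
definition ediam :: "('a \<Rightarrow> 'a \<Rightarrow> real) \<Rightarrow> 'a set \<Rightarrow> ennreal" where
  "ediam \<rho> U = (SUP x\<in>U. SUP y\<in>U. ennreal (\<rho> x y))"

lemma (in Metric_space) equiv_delta_equiv: "equiv M (delta_equiv M d \<delta>)"
proof (rule equivI)
  show "delta_equiv M d \<delta> \<subseteq> M \<times> M"
    unfolding delta_equiv_def by (auto dest: hd_in_set last_in_set)
  show "refl_on M (delta_equiv M d \<delta>)"
    unfolding refl_on_def delta_equiv_def by (auto intro!: exI[of _ "[_]"])
  show "sym (delta_equiv M d \<delta>)"
  proof (rule symI)
    fix x y assume "(x, y) \<in> delta_equiv M d \<delta>"
    then obtain zs where zs: "zs \<noteq> []" "set zs \<subseteq> M" "hd zs = x" "last zs = y"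
      "\<And>i. Suc i < length zs \<Longrightarrow> d (zs ! i) (zs ! Suc i) \<le> \<delta>"
      unfolding delta_equiv_def by auto
    have "d (rev zs ! i) (rev zs ! Suc i) \<le> \<delta>" if "Suc i < length zs" for i
    proof -
      have "length zs - Suc i = Suc (length zs - Suc (Suc i))" using that by simp
      then show ?thesis
        using that zs(5)[of "length zs - Suc (Suc i)"] by (simp add: rev_nth commute)
    qed
    then show "(y, x) \<in> delta_equiv M d \<delta>"
      using zs unfolding delta_equiv_def
      by (auto intro!: exI[of _ "rev zs"] simp: hd_rev last_rev)
  qed
  show "trans (delta_equiv M d \<delta>)"
  proof (rule transI)
    fix x y z assume "(x, y) \<in> delta_equiv M d \<delta>" "(y, z) \<in> delta_equiv M d \<delta>"
    then obtain us vs where us: "us \<noteq> []" "set us \<subseteq> M" "hd us = x" "last us = y"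
        "\<And>i. Suc i < length us \<Longrightarrow> d (us ! i) (us ! Suc i) \<le> \<delta>"
      and vs: "vs \<noteq> []" "set vs \<subseteq> M" "hd vs = y" "last vs = z"
        "\<And>i. Suc i < length vs \<Longrightarrow> d (vs ! i) (vs ! Suc i) \<le> \<delta>"
      unfolding delta_equiv_def by auto
    let ?w = "us @ tl vs"
    have "d (?w ! i) (?w ! Suc i) \<le> \<delta>" if i: "Suc i < length ?w" for i
    proof -
      consider "Suc i < length us" | "Suc i = length us" | "length us \<le> i" by linarith
      then show ?thesis
      proof cases
        case 1 then show ?thesis using us(5) by (simp add: nth_append)
      next
        case 2
        have "us ! i = vs ! 0" using 2 us vs
          by (metis diff_Suc_1 hd_conv_nth last_conv_nth)
        then show ?thesis using 2 i vs(5)[of 0] by (simp add: nth_append nth_tl)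
      next
        case 3
        then show ?thesis using i vs(5)[of "Suc (i - length us)"]
          by (simp add: nth_append nth_tl Suc_diff_le)
      qed
    qed
    moreover have "last ?w = z"
      using us vs by (cases vs) (auto simp: last_append)
    moreover have "set ?w \<subseteq> M" using us vs by (auto dest: list.set_sel(2))
    ultimately show "(x, z) \<in> delta_equiv M d \<delta>"
      using us unfolding delta_equiv_def by (auto intro!: exI[of _ ?w])
  qed
qed

end

theory Submission
  imports Defs
begin

text \<open>Both conditions compare the step size of a chain with the distance D between its
  endpoints. A chain with steps at most \<delta> whose distinct endpoints satisfy \<delta> \<le>
  \<open>\<delta>\<^sub>0\<close> * D becomes a \<open>\<delta>\<^sub>0\<close>-sequence once its
  loops are erased (\<open>successively_distinct_subchain\<close>,
  \<open>delta_sequence_if_delta_equiv\<close>). Conversely, a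
  \<open>\<delta>\<^sub>0\<close>-sequence is a chain with steps at most
  \<open>\<delta>\<^sub>0\<close> * D (\<open>delta_equiv_if_delta_sequence\<close>). Since a
  diameter bound on components is a distance bound on equivalent pairs
  (\<open>delta_components_ediam_le_iff\<close>), \<open>M\<^sub>0\<close> and
  \<open>\<delta>\<^sub>0\<close> are reciprocal up to a factor 2.\<close>

text \<open>Loop erasure, by induction from the far end: a new first point is either prepended to
  the loop-free chain of the tail or already lies on it.\<close>

lemma successively_distinct_subchain:
  assumes "successively P xs" "xs \<noteq> []"
  shows "\<exists>ys. successively P ys \<and> ys \<noteq> [] \<and> distinct ys \<and> set ys \<subseteq> set xs
    \<and> hd ys = hd xs \<and> last ys = last xs"
  using assms
proof (induction xs)
  case Nil
  then show ?case by simp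
next
  case (Cons x xs)
  show ?case
  proof (cases "xs = []")
    case True
    then show ?thesis by (intro exI[of _ "[x]"]) simp
  next
    case False
    with Cons obtain ys where ys: "successively P ys" "ys \<noteq> []" "distinct ys"
      "set ys \<subseteq> set xs" "hd ys = hd xs" "last ys = last xs"
      by (auto simp: successively_Cons)
    show ?thesis
    proof (cases "x \<in> set ys")
      case True
      \<comment> \<open>The suffix from x onwards skips the loop and keeps the last point.\<close>
      then obtain as bs where "ys = as @ x # bs" by (meson split_list)
      with ys False show ?thesis
        by (intro exI[of _ "x # bs"]) (auto simp: successively_append_iff)
    next
      case x: False
      have "P x (hd ys)" using Cons.prems False ys by (simp add: successively_Cons)
      with x ys False show ?thesis
        by (intro exI[of _ "x # ys"]) (auto simp: successively_Cons)
    qed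
  qed
qed

lemma delta_sequence_iff_successively:
  "delta_sequence X \<rho> \<delta>\<^sub>0 xs \<longleftrightarrow> set xs \<subseteq> X \<and> distinct xs \<and> length xs \<ge> 2 \<and>
     successively (\<lambda>x y. \<rho> x y \<le> \<delta>\<^sub>0 * \<rho> (hd xs) (last xs)) xs"
  unfolding delta_sequence_def successively_conv_nth by auto

lemma delta_equiv_iff_successively:
  "(x, y) \<in> delta_equiv X \<rho> \<delta> \<longleftrightarrow> (\<exists>zs. zs \<noteq> [] \<and> set zs \<subseteq> X \<and> hd zs = x \<and> last zs = y \<and>
     successively (\<lambda>x y. \<rho> x y \<le> \<delta>) zs)"
  unfolding delta_equiv_def successively_conv_nth by auto

context Metric_space
begin

text \<open>The diameter is a supremum over pairs, and two points share a component exactly when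
  they are equivalent. Nonnegativity of c matters because \<open>ennreal\<close> sends negative
  reals to 0, which one-point components would satisfy.\<close>

lemma delta_components_ediam_le_iff:
  assumes "c \<ge> 0"
  shows "(\<forall>U \<in> delta_components M d \<delta>. ediam d U \<le> ennreal c) \<longleftrightarrow>
    (\<forall>(x, y) \<in> delta_equiv M d \<delta>. d x y \<le> c)"
    (is "?L \<longleftrightarrow> ?R")
proof -
  note eq = equiv_delta_equiv[of \<delta>]
  have le: "ediam d U \<le> ennreal c \<longleftrightarrow> (\<forall>x\<in>U. \<forall>y\<in>U. d x y \<le> c)" for U
    unfolding ediam_def using assms by (simp add: SUP_le_iff ennreal_le_iff)
  show ?thesis
  proof
    assume L: ?L
    have "d x y \<le> c" if xy: "(x, y) \<in> delta_equiv M d \<delta>" for x y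
    proof -
      have "x \<in> M" using eq xy by (meson equiv_class_eq_iff)
      then have "delta_equiv M d \<delta> `` {x} \<in> delta_components M d \<delta>"
        unfolding delta_components_def by (rule quotientI)
      moreover have "x \<in> delta_equiv M d \<delta> `` {x}"
        using eq \<open>x \<in> M\<close> by (rule equiv_class_self)
      ultimately show ?thesis using L xy unfolding le by blast
    qed
    then show ?R by blast
  next
    assume R: ?R
    then show ?L
      unfolding le delta_components_def using in_quotient_imp_in_rel[OF eq] by fast
  qed
qed

lemma delta_sequence_if_delta_equiv:
  assumes "(x, y) \<in> delta_equiv M d \<delta>" "x \<noteq> y" "\<delta> \<le> \<delta>\<^sub>0 * d x y"
  shows "\<exists>xs. delta_sequence M d \<delta>\<^sub>0 xs"
proof -
  obtain zs where zs: "zs \<noteq> []" "set zs \<subseteq> M" "hd zs = x" "last zs = y"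
    "successively (\<lambda>x y. d x y \<le> \<delta>) zs"
    using assms(1) unfolding delta_equiv_iff_successively by blast
  then obtain ys where ys: "successively (\<lambda>x y. d x y \<le> \<delta>) ys" "ys \<noteq> []" "distinct ys"
    "set ys \<subseteq> set zs" "hd ys = x" "last ys = y"
    using successively_distinct_subchain by metis
  \<comment> \<open>Distinct endpoints prevent loop erasure from collapsing the chain to one
    point.\<close>
  have "length ys \<ge> 2"
    using ys assms(2) by (cases ys; cases "tl ys") auto
  moreover have "successively (\<lambda>u v. d u v \<le> \<delta>\<^sub>0 * d x y) ys"
    using ys(1) by (rule successively_mono) (use assms(3) in simp)
  ultimately show ?thesis
    unfolding delta_sequence_iff_successively using ys zs(2) by blast
qed

text \<open>Positivity of the endpoint distance, which comes from distinctness of the list, makes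
  the step bound an admissible positive \<delta> when \<open>\<delta>\<^sub>0\<close> is
  positive.\<close>

lemma delta_equiv_if_delta_sequence:
  assumes "delta_sequence M d \<delta>\<^sub>0 xs"
  shows "(hd xs, last xs) \<in> delta_equiv M d (\<delta>\<^sub>0 * d (hd xs) (last xs))"
    and "d (hd xs) (last xs) > 0"
proof -
  have xs: "set xs \<subseteq> M" "distinct xs" "length xs \<ge> 2"
    "successively (\<lambda>x y. d x y \<le> \<delta>\<^sub>0 * d (hd xs) (last xs)) xs"
    using assms unfolding delta_sequence_iff_successively by auto
  then have ne: "xs \<noteq> []" by auto
  then show "(hd xs, last xs) \<in> delta_equiv M d (\<delta>\<^sub>0 * d (hd xs) (last xs))"
    unfolding delta_equiv_iff_successively using xs by blast
  have "hd xs \<noteq> last xs"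
    using xs(2,3) by (cases xs) (auto split: if_splits)
  then show "d (hd xs) (last xs) > 0"
    using xs(1) ne by (simp add: mdist_pos_less subset_iff)
qed

end

theorem theorem1p2:
  fixes X :: "'a set" and \<rho> :: "'a \<Rightarrow> 'a \<Rightarrow> real"
  assumes "Metric_space X \<rho>"
  shows "uniformly_disconnected X \<rho> \<longleftrightarrow>
    (\<exists>M\<^sub>0::real. M\<^sub>0 > 0 \<and>
      (\<forall>\<delta>>0. \<forall>U \<in> delta_components X \<rho> \<delta>. ediam \<rho> U \<le> ennreal (M\<^sub>0 * \<delta>)))"
proof -
  interpret Metric_space X \<rho> by fact
  show ?thesis
  proof
    assume "uniformly_disconnected X \<rho>"
    then obtain \<delta>\<^sub>0 where d0: "\<delta>\<^sub>0 > 0" "\<And>xs. \<not> delta_sequence X \<rho> \<delta>\<^sub>0 xs"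
      unfolding uniformly_disconnected_def by blast
    have "\<forall>U \<in> delta_components X \<rho> \<delta>. ediam \<rho> U \<le> ennreal (1 / \<delta>\<^sub>0 * \<delta>)" if "\<delta> > 0" for \<delta>
    proof -
      \<comment> \<open>Failure of this bound is the strict form of the threshold in
        \<open>delta_sequence_if_delta_equiv\<close>.\<close>
      have "\<rho> x y \<le> 1 / \<delta>\<^sub>0 * \<delta>" if xy: "(x, y) \<in> delta_equiv X \<rho> \<delta>" for x y
      proof (rule ccontr)
        assume "\<not> ?thesis"
        then have gt: "\<delta> < \<delta>\<^sub>0 * \<rho> x y" using d0(1) by (simp add: field_simps)
        \<comment> \<open>Membership in X gives \<rho> x x = 0, so x = y would contradict
          \<open>gt\<close> and \<delta> > 0.\<close>
        moreover have "x \<in> X" using xy equiv_delta_equiv by (meson equiv_class_eq_iff)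
        ultimately have "x \<noteq> y" using \<open>\<delta> > 0\<close> by auto
        then show False using delta_sequence_if_delta_equiv[OF xy _ less_imp_le[OF gt]] d0(2) by blast
      qed
      then show ?thesis
        using d0(1) that by (subst delta_components_ediam_le_iff) auto
    qed
    then show "\<exists>M\<^sub>0>0. \<forall>\<delta>>0. \<forall>U \<in> delta_components X \<rho> \<delta>. ediam \<rho> U \<le> ennreal (M\<^sub>0 * \<delta>)"
      using d0(1) by (intro exI[of _ "1 / \<delta>\<^sub>0"]) simp
  next
    assume "\<exists>M\<^sub>0>0. \<forall>\<delta>>0. \<forall>U \<in> delta_components X \<rho> \<delta>. ediam \<rho> U \<le> ennreal (M\<^sub>0 * \<delta>)"
    then obtain M\<^sub>0 where M0: "M\<^sub>0 > 0"
      "\<And>\<delta>. \<delta> > 0 \<Longrightarrow> \<forall>U \<in> delta_components X \<rho> \<delta>. ediam \<rho> U \<le> ennreal (M\<^sub>0 * \<delta>)"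
      by blast
    \<comment> \<open>The factor 2 makes the contradiction strict: the component bound yields D
      \<le> D / 2 with D > 0, whereas 1 / \<open>M\<^sub>0\<close> would only yield D \<le>
      D.\<close>
    have "\<not> delta_sequence X \<rho> (1 / (2 * M\<^sub>0)) xs" for xs
    proof
      assume seq: "delta_sequence X \<rho> (1 / (2 * M\<^sub>0)) xs"
      let ?D = "\<rho> (hd xs) (last xs)"
      let ?\<delta> = "1 / (2 * M\<^sub>0) * ?D"
      have D: "?D > 0" and "(hd xs, last xs) \<in> delta_equiv X \<rho> ?\<delta>"
        using delta_equiv_if_delta_sequence[OF seq] by auto
      moreover have "\<forall>(x, y) \<in> delta_equiv X \<rho> ?\<delta>. \<rho> x y \<le> M\<^sub>0 * ?\<delta>"
        by (rule iffD1[OF delta_components_ediam_le_iff M0(2)]) (use D M0(1) in auto)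
      ultimately have "?D \<le> M\<^sub>0 * ?\<delta>" by blast
      then show False using D M0(1) by (simp add: field_simps)
    qed
    then show "uniformly_disconnected X \<rho>"
      unfolding uniformly_disconnected_def using M0(1)
      by (intro exI[of _ "1 / (2 * M\<^sub>0)"]) simp
  qed
qed

end
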